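(* Let $Y_{\mathcal A}$ be the admittance matrix of a connected electrical network with boundary nodes $\{1,\dots,N\}$, and let $Y$ be its Kron-reduced admittance matrix. The following statements hold. 1) Invariance under Kron reduction: the effective impedance between any two boundary nodes is equal when computed from $Y$ or from $Y_{\mathcal A}$, that is, for any $n,m\in\{1,\dots,N\}$, $$z_{nm}=(e_n-e_m)^{\mathrm T}Y^\dagger(e_n-e_m)=(e_n-e_m)^{\mathrm T}Y_{\mathcal A}^\dagger(e_n-e_m).$$ 2) Invariance under augmentation: if $Y_{\mathcal A}$ is nonsingular, then the effective impedance is equal when computed from $Y_{\mathcal A}$ or from the augmented admittance matrix $\widehat Y_{\mathcal A}$, that is, for any $n,m\in\{1,\dots,|\mathcal A|\}$, $$z_{nm}=(e_n-e_m)^{\mathrm T}Y_{\mathcal A}^{-1}(e_n-e_m)=(e_n-e_m)^{\mathrm T}\widehat Y_{\mathcal A}^\dagger(e_n-e_m).$$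
   Context: Network. A connected undirected graph has node set $\mathcal A=\{1,\dots,|\mathcal A|\}$ and edge (branch) set $\mathcal E$; $\mathcal N=\{1,\dots,N\}\subseteq\mathcal A$ are the boundary nodes and $\mathcal I=\mathcal A\setminus\mathcal N$ the interior nodes. Each branch $(m,n)\in\mathcal E$ has a nonzero admittance $y_{mn}=y_{nm}\in\mathbb C$ and each node $m$ has a shunt admittance $y_m\in\mathbb C$ to ground, with $y_m=0$ for $m\in\mathcal N$. The (complex-symmetric) admittance matrix $Y_{\mathcal A}$ has entries $[Y_{\mathcal A}]_{mm}=y_m+\sum_{(m,k)\in\mathcal E}y_{mk}$, $[Y_{\mathcal A}]_{mn}=-y_{mn}$ if $(m,n)\in\mathcal E$, and $0$ otherwise. Write $$Y_{\mathcal A}=\begin{bmatrix}Y_{\mathcal{NN}}&Y_{\mathcal{NI}}\\ Y_{\mathcal{NI}}^{\mathrm T}&Y_{\mathcal{II}}\end{bmatrix},\qquad Y:=Y_{\mathcal{NN}}-Y_{\mathcal{NI}}Y_{\mathcal{II}}^{-1}Y_{\mathcal{NI}}^{\mathrm T}\in\mathbb C^{N\times N},$$ where $Y$ is the Kron-reduced admittance matrix. The augmented admittance matrix models the ground as an additional node $|\mathcal A|+1$: $$\widehat Y_{\mathcal A}=\begin{bmatrix}Y_{\mathcal A}&-y\\-y^{\mathrm T}&\sum_{m=1}^{|\mathcal A|}y_m\end{bmatrix},\qquad y=[y_1,\dots,y_{|\mathcal A|}]^{\mathrm T}.$$ $U^\dagger$ is the Moore-Penrose pseudoinverse, $e_n$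 is the $n$th canonical basis vector of the appropriate dimension, and $(\cdot)^{\mathrm T}$ is transposition without conjugation. Standing assumption: all proper principal submatrices of $Y_{\mathcal A}$ are nonsingular, and $Y_{\mathcal A}$ itself is nonsingular whenever at least one shunt admittance is nonzero. *)

theory Defs
  imports
    "Graph_Theory.Graph_Theory"
    "Jordan_Normal_Form.Gauss_Jordan_Elimination"
    "Jordan_Normal_Form.Schur_Decomposition"
    "Jordan_Normal_Form.DL_Submatrix"
begin

section \<open>Inverse and Moore-Penrose pseudoinverse\<close>

text \<open>The library function \<^const>\<open>mat_inverse\<close> is option-valued; the value below is
  meaningful for invertible matrices only.\<close>

definition mat_inv :: "complex mat \<Rightarrow> complex mat" where
  "mat_inv A = the (mat_inverse A)"

lemma mat_inv:
  assumes "invertible_mat A" and A: "A \<in> carrier_mat n n"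
  shows "mat_inv A \<in> carrier_mat n n" "A * mat_inv A = 1\<^sub>m n" "mat_inv A * A = 1\<^sub>m n"
proof -
  from assms obtain B where B: "A * B = 1\<^sub>m n" "B * A = 1\<^sub>m (dim_row B)"
    unfolding invertible_mat_def inverts_mat_def by auto
  from arg_cong[OF B(1), of dim_col] arg_cong[OF B(2), of dim_col] A
  have "B \<in> carrier_mat n n" by auto
  with B A have "A \<in> Units (ring_mat TYPE(complex) n ())"
    unfolding Units_def ring_mat_def by auto
  then obtain C where "mat_inverse A = Some C"
    using mat_inverse(1)[OF A, of "()"] by (cases "mat_inverse A") auto
  with mat_inverse(2)[OF A this]
  show "mat_inv A \<in> carrier_mat n n" "A * mat_inv A = 1\<^sub>m n" "mat_inv A * A = 1\<^sub>m n"
    by (auto simp: mat_inv_def)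
qed

definition is_pseudoinverse :: "complex mat \<Rightarrow> complex mat \<Rightarrow> bool" where
  "is_pseudoinverse A X \<longleftrightarrow>
     X \<in> carrier_mat (dim_col A) (dim_row A) \<and>
     A * X * A = A \<and> X * A * X = X \<and>
     mat_adjoint (A * X) = A * X \<and> mat_adjoint (X * A) = X * A"

definition pseudoinverse :: "complex mat \<Rightarrow> complex mat" where
  "pseudoinverse A = (THE X. is_pseudoinverse A X)"

text \<open>The definite description is justified by existence and uniqueness.\<close>

lemma mat_adjoint_dim [simp]:
  "dim_row (mat_adjoint A) = dim_col A" "dim_col (mat_adjoint A) = dim_row A"
  by (auto simp: mat_adjoint_def)

lemma mat_adjoint_carrier [simp]:
  "A \<in> carrier_mat m n \<Longrightarrow> mat_adjoint A \<in> carrier_mat n m"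
  by (intro carrier_matI) auto

lemma mat_adjoint_index [simp]:
  fixes A :: "complex mat"
  assumes "i < dim_col A" "j < dim_row A"
  shows "mat_adjoint A $$ (i, j) = cnj (A $$ (j, i))"
  using assms by (simp add: mat_adjoint_def mat_of_rows_index)

lemma mat_adjoint_mat_adjoint [simp]: "mat_adjoint (mat_adjoint A) = (A :: complex mat)"
  by (rule eq_matI) auto

lemma mat_adjoint_mult:
  fixes A B :: "complex mat"
  assumes "A \<in> carrier_mat m n" "B \<in> carrier_mat n k"
  shows "mat_adjoint (A * B) = mat_adjoint B * mat_adjoint A"
  by (rule eq_matI) (use assms in \<open>auto simp: scalar_prod_def mult.commute\<close>)

lemma index_mult_mat_sum:
  fixes A B :: "complex mat"
  assumes "A \<in> carrier_mat m n" "B \<in> carrier_mat n k" "i < m" "j < k"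
  shows "(A * B) $$ (i, j) = (\<Sum>l<n. A $$ (i, l) * B $$ (l, j))"
  using assms by (auto simp: scalar_prod_def lessThan_atLeast0)

lemma adjoint_mult_self_eq_0:
  fixes A :: "complex mat"
  assumes A: "A \<in> carrier_mat m n" and 0: "mat_adjoint A * A = 0\<^sub>m n n"
  shows "A = 0\<^sub>m m n"
proof (rule eq_matI)
  fix i j assume ij: "i < dim_row (0\<^sub>m m n)" "j < dim_col (0\<^sub>m m n)"
  have "0 = (mat_adjoint A * A) $$ (j, j)" using 0 ij by simp
  also have "\<dots> = (\<Sum>k<m. cnj (A $$ (k, j)) * A $$ (k, j))"
    using A ij by (auto simp: scalar_prod_def lessThan_atLeast0)
  also have "\<dots> = of_real (\<Sum>k<m. (cmod (A $$ (k, j)))\<^sup>2)"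
    unfolding of_real_sum by (intro sum.cong) (simp_all add: complex_norm_square mult.commute del: of_real_power)
  finally have "(\<Sum>k<m. (cmod (A $$ (k, j)))\<^sup>2) = 0" by (metis of_real_eq_0_iff)
  then have "(cmod (A $$ (i, j)))\<^sup>2 = 0"
    using ij by (subst (asm) sum_nonneg_eq_0_iff) auto
  then show "A $$ (i, j) = 0\<^sub>m m n $$ (i, j)" using ij by simp
qed (use A in auto)

lemma mult_mat_assoc:
  fixes A B C :: "complex mat"
  assumes "dim_col A = dim_row B" "dim_col B = dim_row C"
  shows "A * B * C = A * (B * C)"
  using assms by (intro assoc_mult_mat) auto

lemma adjoint_mult_cancel:
  fixes A :: "complex mat"
  assumes A: "A \<in> carrier_mat m n" and X: "X \<in> carrier_mat n k" and Y: "Y \<in> carrier_mat n k"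
    and eq: "mat_adjoint A * (A * X) = mat_adjoint A * (A * Y)"
  shows "A * X = A * Y"
proof -
  have XY: "X - Y \<in> carrier_mat n k" using Y by (rule minus_carrier_mat)
  let ?D = "A * (X - Y)"
  have D: "?D \<in> carrier_mat m k" using A XY by (rule mult_carrier_mat)
  have D_eq: "?D = A * X - A * Y" using A X Y by (rule mult_minus_distrib_mat)
  have "mat_adjoint ?D * ?D = mat_adjoint (X - Y) * (mat_adjoint A * ?D)"
    unfolding mat_adjoint_mult[OF A XY] using A XY by (intro mult_mat_assoc) auto
  also have "mat_adjoint A * ?D = mat_adjoint A * (A * X) - mat_adjoint A * (A * Y)"
    unfolding D_eq using A X Y by (intro mult_minus_distrib_mat) auto
  also have "\<dots> = 0\<^sub>m n k"
    unfolding eq using A Y by (intro minus_r_inv_mat) auto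
  also have "mat_adjoint (X - Y) * 0\<^sub>m n k = 0\<^sub>m k k"
    using XY by (intro right_mult_zero_mat) auto
  finally have D0: "A * X - A * Y = 0\<^sub>m m k"
    using adjoint_mult_self_eq_0[OF D] D_eq by simp
  show ?thesis
  proof (rule eq_matI)
    fix i j assume "i < dim_row (A * Y)" "j < dim_col (A * Y)"
    then have ij: "i < m" "j < k" using A Y by auto
    have "(A * X - A * Y) $$ (i, j) = 0" unfolding D0 using ij by simp
    then show "(A * X) $$ (i, j) = (A * Y) $$ (i, j)"
      using ij A Y by (subst (asm) index_minus_mat) auto
  qed (use A X Y in auto)
qed

lemma is_pseudoinverse_unique:
  assumes X: "is_pseudoinverse A X" and Y: "is_pseudoinverse A Y"
  shows "X = Y"
proof -
  obtain m n where A: "A \<in> carrier_mat m n" using carrier_matI by blast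
  from X Y A have Xc: "X \<in> carrier_mat n m" and Yc: "Y \<in> carrier_mat n m"
    by (auto simp: is_pseudoinverse_def)
  have dims: "dim_row A = m" "dim_col A = n" "dim_row X = n" "dim_col X = m" "dim_row Y = n" "dim_col Y = m"
    using A Xc Yc by auto
  have XA: "A * X * A = A" "X * A * X = X" "mat_adjoint (A * X) = A * X" "mat_adjoint (X * A) = X * A"
    and YA: "A * Y * A = A" "Y * A * Y = Y" "mat_adjoint (A * Y) = A * Y" "mat_adjoint (Y * A) = Y * A"
    using X Y by (auto simp: is_pseudoinverse_def)
  have "A * X = A * Y * A * X" by (simp only: YA)
  also have "\<dots> = A * Y * (A * X)" by (rule mult_mat_assoc) (auto simp: dims)
  also have "\<dots> = mat_adjoint (A * Y) * mat_adjoint (A * X)" by (simp only: XA YA)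
  also have "\<dots> = mat_adjoint (A * X * (A * Y))"
    using A Xc Yc by (intro mat_adjoint_mult[symmetric]) auto
  also have "A * X * (A * Y) = A * X * A * Y" by (rule mult_mat_assoc[symmetric]) (auto simp: dims)
  also have "mat_adjoint \<dots> = A * Y" by (simp only: XA YA)
  finally have 1: "A * X = A * Y" .
  have "X * A = X * (A * Y * A)" by (simp only: YA)
  also have "\<dots> = X * A * (Y * A)" by (simp add: mult_mat_assoc dims)
  also have "\<dots> = mat_adjoint (X * A) * mat_adjoint (Y * A)" by (simp only: XA YA)
  also have "\<dots> = mat_adjoint (Y * A * (X * A))"
    using A Xc Yc by (intro mat_adjoint_mult[symmetric]) auto
  also have "Y * A * (X * A) = Y * (A * X * A)" by (simp add: mult_mat_assoc dims)
  also have "mat_adjoint \<dots> = Y * A" by (simp only: XA YA)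
  finally have 2: "X * A = Y * A" .
  have "X = Y * A * X" using XA(2) 2 by simp
  also have "\<dots> = Y * (A * X)" by (rule mult_mat_assoc) (auto simp: dims)
  also have "\<dots> = Y * A * Y" unfolding 1 by (rule mult_mat_assoc[symmetric]) (auto simp: dims)
  finally show ?thesis using YA(2) by simp
qed

lemma ex_generalized_inverse:
  fixes A :: "complex mat"
  assumes A: "A \<in> carrier_mat m n"
  shows "\<exists>G \<in> carrier_mat n m. A * G * A = A"
proof -
  define R where "R = gauss_jordan_single A"
  note gj = gauss_jordan_single[OF A R_def[symmetric]]
  from gj(4) obtain P Q where PQ: "R = P * A" "P \<in> carrier_mat m m" "Q \<in> carrier_mat m m"
    "P * Q = 1\<^sub>m m" "Q * P = 1\<^sub>m m" by blast
  have R: "R \<in> carrier_mat m n" by (rule gj(2))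
  from gj(3) R obtain f where f: "pivot_fun R f n" unfolding row_echelon_form_def by auto
  note f = pivot_funD[OF _ f, of m]
  define H where "H = mat n m (\<lambda>(i, j). if i = f j then 1 else (0 :: complex))"
  have H: "H \<in> carrier_mat n m" by (simp add: H_def)
  have RH: "(R * H) $$ (i, k) = (if f k < n \<and> i = k then 1 else 0)" if "i < m" "k < m" for i k
  proof -
    have "(R * H) $$ (i, k) = (\<Sum>j<n. if j = f k then R $$ (i, j) else 0)"
      unfolding index_mult_mat_sum[OF R H that] using that by (intro sum.cong) (auto simp: H_def)
    also have "\<dots> = (if f k < n then R $$ (i, f k) else 0)" by simp
    also have "\<dots> = (if f k < n \<and> i = k then 1 else 0)"
      using f(4)[of k] f(5)[of k i] that R by auto
    finally show ?thesis .
  qed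
  have RHR: "R * H * R = R"
  proof (rule eq_matI)
    fix i j assume "i < dim_row R" "j < dim_col R"
    then have ij: "i < m" "j < n" using R by auto
    have "(R * H * R) $$ (i, j) = (\<Sum>k<m. (R * H) $$ (i, k) * R $$ (k, j))"
      using R H ij by (intro index_mult_mat_sum[of _ m m _ n]) auto
    also have "\<dots> = (\<Sum>k<m. if k = i then (if f i < n then R $$ (i, j) else 0) else 0)"
      using ij by (intro sum.cong) (auto simp: RH)
    also have "\<dots> = (if f i < n then R $$ (i, j) else 0)" using ij by simp
    also have "\<dots> = R $$ (i, j)" using f(1)[of i] f(2)[of i j] ij R by auto
    finally show "(R * H * R) $$ (i, j) = R $$ (i, j)" .
  qed (use R H in auto)
  have dims: "dim_row A = m" "dim_col A = n" "dim_row H = n" "dim_col H = m"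
    "dim_row P = m" "dim_col P = m" "dim_row Q = m" "dim_col Q = m" "dim_row R = m" "dim_col R = n"
    using A H PQ(2,3) R by auto
  have "Q * P * A = A" using A PQ(5) by simp
  then have A_eq: "A = Q * R" unfolding PQ(1) by (simp add: mult_mat_assoc dims)
  have "A * (H * P) * A = A * (H * (P * A))" by (simp add: mult_mat_assoc dims)
  also have "\<dots> = Q * R * (H * R)" using A_eq PQ(1) by simp
  also have "\<dots> = Q * (R * H * R)" by (simp add: mult_mat_assoc dims)
  also have "\<dots> = A" by (simp only: RHR A_eq[symmetric])
  finally show ?thesis using H PQ(2) by (intro bexI[of _ "H * P"]) auto
qed

lemma ex_hermitian_projection:
  fixes A :: "complex mat"
  assumes A: "A \<in> carrier_mat m n"
  shows "\<exists>X \<in> carrier_mat n m. A * X * A = A \<and> mat_adjoint (A * X) = A * X"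
proof -
  define B where "B = mat_adjoint A"
  have B: "B \<in> carrier_mat n m" using A by (simp add: B_def)
  obtain H where H: "H \<in> carrier_mat n n" "B * A * H * (B * A) = B * A"
    using ex_generalized_inverse[of "B * A" n n] A B by auto
  define X where "X = H * B"
  have X: "X \<in> carrier_mat n m" using H B by (auto simp: X_def)
  define H' where "H' = mat_adjoint H"
  have H': "H' \<in> carrier_mat n n" using H by (simp add: H'_def)
  have dims: "dim_row A = m" "dim_col A = n" "dim_row B = n" "dim_col B = m" "dim_row H = n" "dim_col H = n"
    "dim_row X = n" "dim_col X = m" "dim_row H' = n" "dim_col H' = n"
    using A B H X H' by auto
  have "B * (A * (X * A)) = B * A * H * (B * A)"
    unfolding X_def by (simp add: mult_mat_assoc dims)
  also have "\<dots> = B * (A * 1\<^sub>m n)" using H(2) A by simp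
  finally have "A * (X * A) = A * 1\<^sub>m n"
    using A X unfolding B_def by (intro adjoint_mult_cancel[OF A]) auto
  then have P: "A * X * A = A"
    using A by (simp add: mult_mat_assoc dims)
  have "mat_adjoint (A * X) = mat_adjoint X * B" unfolding B_def using A X by (rule mat_adjoint_mult)
  also have "mat_adjoint X = A * H'"
    unfolding X_def H'_def using mat_adjoint_mult[OF H(1) B] by (simp add: B_def)
  also have "A * H' * B = A * (H' * B)" by (simp add: mult_mat_assoc dims)
  finally have P_adj: "mat_adjoint (A * X) = A * (H' * B)" .
  have "A * X * mat_adjoint (A * X) = A * X * A * (H' * B)"
    unfolding P_adj by (simp add: mult_mat_assoc dims)
  also have "\<dots> = mat_adjoint (A * X)" by (simp only: P P_adj)
  finally have 1: "A * X * mat_adjoint (A * X) = mat_adjoint (A * X)" .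
  have "mat_adjoint (A * X * mat_adjoint (A * X)) = A * X * mat_adjoint (A * X)"
    using mat_adjoint_mult[of "A * X" m m "mat_adjoint (A * X)" m] A X by simp
  then have "mat_adjoint (mat_adjoint (A * X)) = mat_adjoint (A * X)" unfolding 1 .
  then have "mat_adjoint (A * X) = A * X" unfolding mat_adjoint_mat_adjoint by (rule sym)
  with P X show ?thesis by blast
qed

lemma ex_is_pseudoinverse: "\<exists>X. is_pseudoinverse A X"
proof -
  obtain m n where A: "A \<in> carrier_mat m n" using carrier_matI by blast
  define B where "B = mat_adjoint A"
  have B: "B \<in> carrier_mat n m" using A by (simp add: B_def)
  obtain X where X: "X \<in> carrier_mat n m" "A * X * A = A" "mat_adjoint (A * X) = A * X"
    using ex_hermitian_projection[OF A] by blast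
  obtain Y where Y: "Y \<in> carrier_mat m n" "B * Y * B = B" "mat_adjoint (B * Y) = B * Y"
    using ex_hermitian_projection[OF B] by blast
  define Z where "Z = mat_adjoint Y"
  have Z: "Z \<in> carrier_mat n m" using Y by (simp add: Z_def)
  define W where "W = Z * A * X"
  have W: "W \<in> carrier_mat n m" using Z A X by (auto simp: W_def)
  have dims: "dim_row A = m" "dim_col A = n" "dim_row B = n" "dim_col B = m" "dim_row X = n" "dim_col X = m"
    "dim_row Z = n" "dim_col Z = m" "dim_row W = n" "dim_col W = m" "dim_row Y = m" "dim_col Y = n"
    using A B X Z W Y by auto
  have BY: "B * Y = Z * A"
    using mat_adjoint_mult[OF B Y(1)] Y(3) by (simp add: Z_def B_def)
  have "A = mat_adjoint (B * Y * B)" using Y(2) by (simp add: B_def)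
  also have "\<dots> = mat_adjoint B * mat_adjoint (B * Y)"
    using B Y(1) by (intro mat_adjoint_mult) auto
  also have "mat_adjoint (B * Y) = Z * A" using Y(3) BY by (rule trans)
  also have "mat_adjoint B = A" by (simp add: B_def)
  also have "A * (Z * A) = A * Z * A" by (simp add: mult_mat_assoc dims)
  finally have AZA: "A * Z * A = A" by (rule sym)
  have "A * W = A * Z * A * X" unfolding W_def by (simp add: mult_mat_assoc dims)
  then have AW: "A * W = A * X" by (simp only: AZA)
  have "W * A = Z * (A * X * A)" unfolding W_def by (simp add: mult_mat_assoc dims)
  then have WA: "W * A = Z * A" by (simp only: X)
  have "A * W * A = A" unfolding AW by (rule X)
  moreover have "W * A * W = Z * (A * W)" unfolding WA by (simp add: mult_mat_assoc dims)
  then have "W * A * W = W" unfolding AW by (simp add: W_def mult_mat_assoc dims)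
  moreover have "mat_adjoint (Z * A) = Z * A" using Y(3) unfolding BY .
  ultimately have "is_pseudoinverse A W"
    using A W X(3) unfolding is_pseudoinverse_def by (simp add: AW WA)
  then show ?thesis ..
qed

lemma pseudoinverse: "is_pseudoinverse A (pseudoinverse A)"
  unfolding pseudoinverse_def
  by (rule theI') (use ex_is_pseudoinverse is_pseudoinverse_unique in blast)

section \<open>Electrical networks\<close>

text \<open>Nodes are numbered from 0, in line with the matrix indices: the nodes are
  \<open>0, \<dots>, a - 1\<close> and the boundary nodes are \<open>0, \<dots>, N - 1\<close>.
  An undirected branch is represented by its two opposite arcs.\<close>

locale electrical_network = pair_graph G for G :: "nat pair_pre_digraph" +
  fixes a N :: nat
    and y :: "nat \<Rightarrow> nat \<Rightarrow> complex"
    and s :: "nat \<Rightarrow> complex" \<comment> \<open>shunt admittances\<close>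
  assumes nodes: "pverts G = {..<a}"
    and connected: "connected (with_proj G)"
    and boundary: "1 \<le> N" "N \<le> a"
    and admittance_nonzero: "(m, n) \<in> parcs G \<Longrightarrow> y m n \<noteq> 0"
    and admittance_sym: "(m, n) \<in> parcs G \<Longrightarrow> y m n = y n m"
    and boundary_shunt: "m < N \<Longrightarrow> s m = 0"

definition admittance_matrix ::
  "nat pair_pre_digraph \<Rightarrow> nat \<Rightarrow> (nat \<Rightarrow> nat \<Rightarrow> complex) \<Rightarrow> (nat \<Rightarrow> complex) \<Rightarrow> complex mat" where
  "admittance_matrix G a y s = mat a a (\<lambda>(m, n).
     if m = n then s m + (\<Sum>k | (m, k) \<in> parcs G. y m k)
     else if (m, n) \<in> parcs G then - y m n
     else 0)"

definition kron_reduction :: "complex mat \<Rightarrow> nat \<Rightarrow> complex mat" where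
  "kron_reduction Y N = (case split_block Y N N of (NN, NI, _, II) \<Rightarrow>
     NN - NI * mat_inv II * transpose_mat NI)"

text \<open>The ground is the additional last node, with index \<open>a\<close>.\<close>

definition augmented_admittance_matrix ::
  "nat pair_pre_digraph \<Rightarrow> nat \<Rightarrow> (nat \<Rightarrow> nat \<Rightarrow> complex) \<Rightarrow> (nat \<Rightarrow> complex) \<Rightarrow> complex mat" where
  "augmented_admittance_matrix G a y s =
     four_block_mat
       (admittance_matrix G a y s)      (- mat_of_cols a [vec a s])
       (- mat_of_rows a [vec a s])      (mat 1 1 (\<lambda>_. \<Sum>m<a. s m))"

definition node_diff :: "nat \<Rightarrow> nat \<Rightarrow> nat \<Rightarrow> complex vec" where
  "node_diff d n m = unit_vec d n - unit_vec d m"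

text \<open>The scalar product of vectors \<open>\<bullet>\<close> does not conjugate, so \<open>v \<bullet> w\<close> is
  \<open>v\<close> transposed times \<open>w\<close>.\<close>

definition effective_impedance :: "complex mat \<Rightarrow> nat \<Rightarrow> nat \<Rightarrow> complex" where
  "effective_impedance Y n m =
     node_diff (dim_row Y) n m \<bullet> (pseudoinverse Y *\<^sub>v node_diff (dim_row Y) n m)"

end

theory Submission
  imports Defs
begin

text \<open>For a symmetric matrix \<open>A\<close> and any solution \<open>x\<close> of \<open>A x = b\<close>, the first Penrose equation
  gives \<open>b\<^sup>T A\<^sup>\<dagger> b = x\<^sup>T A A\<^sup>\<dagger> A x = b\<^sup>T x\<close>, so an effective impedance can be read off any potential
  \<open>x\<close> that produces the injection \<open>b = e\<^sub>n - e\<^sub>m\<close>. Such a potential exists: if there are no shunts,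
  ground node 0 and solve for the remaining nodes; the equation at node 0 then holds because
  currents sum to zero. Restricting a potential to the boundary nodes gives a potential of the
  Kron-reduced network, and extending it by 0 at the ground gives one of the augmented network.\<close>

section \<open>Effective impedance from a potential\<close>

lemma node_diff_carrier [simp]: "node_diff d n m \<in> carrier_vec d"
  by (simp add: node_diff_def)

lemma node_diff_append:
  assumes "n < d" "m < d"
  shows "node_diff (d + k) n m = node_diff d n m @\<^sub>v 0\<^sub>v k"
  by (rule eq_vecI) (use assms in \<open>auto simp: node_diff_def unit_vec_def\<close>)

lemma effective_impedance_eq_scalar_prod:
  assumes A: "A \<in> carrier_mat d d" and sym: "transpose_mat A = A"
    and x: "x \<in> carrier_vec d" and Ax: "A *\<^sub>v x = node_diff d n m"
  shows "effective_impedance A n m = node_diff d n m \<bullet> x"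
proof -
  define P where "P = pseudoinverse A"
  have P: "P \<in> carrier_mat d d" and APA: "A * P * A = A"
    using pseudoinverse[of A] A by (auto simp: is_pseudoinverse_def P_def)
  let ?w = "P *\<^sub>v (A *\<^sub>v x)"
  have w: "?w \<in> carrier_vec d" using A P x by simp
  have "effective_impedance A n m = (A *\<^sub>v x) \<bullet> ?w"
    using A by (simp add: effective_impedance_def Ax P_def)
  \<comment> \<open>The product does not conjugate, so symmetry under transposition lets
    \<open>A\<close> change sides although \<open>A\<close> is complex and in general not
    Hermitian.\<close>
  also have "\<dots> = x \<bullet> (A *\<^sub>v ?w)"
    using transpose_vec_mult_scalar[OF A w x] sym A x w
    by (simp add: comm_scalar_prod[of "A *\<^sub>v x" d ?w] comm_scalar_prod[of x d "A *\<^sub>v ?w"])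
  also have "A *\<^sub>v ?w = (A * P * A) *\<^sub>v x"
    using A P x by (simp add: assoc_mult_mat_vec[of _ d d _ d])
  also have "x \<bullet> \<dots> = node_diff d n m \<bullet> x"
    using x by (simp add: APA Ax comm_scalar_prod[of x d])
  finally show ?thesis .
qed

lemma mult_mat_zero_vec:
  assumes "A \<in> carrier_mat m n"
  shows "A *\<^sub>v 0\<^sub>v n = 0\<^sub>v m"
  by (rule eq_vecI) (use assms in auto)

section \<open>Block decomposition of symmetric matrices\<close>

text \<open>Invertibility is assumed for \<open>submatrix\<close> with an index set, whereas Kron
  reduction works with \<open>split_block\<close>; the explicit entries identify the two.\<close>

lemma submatrix_atLeastLessThan:
  assumes A: "A \<in> carrier_mat n n" and k: "k \<le> n"
  shows "submatrix A {k..<n} {k..<n} = mat (n - k) (n - k) (\<lambda>(i, j). A $$ (k + i, k + j))"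
proof -
  have "{i. i < n \<and> i \<in> {k..<n}} = {k..<n}" by auto
  then have S: "card {i. i < n \<and> i \<in> {k..<n}} = n - k" by simp
  \<comment> \<open>Exactly \<open>i\<close> elements of the interval lie below
    \<open>k + i\<close>, so \<open>pick\<close> at \<open>i\<close> returns it.\<close>
  have pick: "pick {k..<n} i = k + i" if "i < n - k" for i
  proof -
    have "{l \<in> {k..<n}. l < k + i} = {k..<k + i}" using that by auto
    then have "card {l \<in> {k..<n}. l < k + i} = i" by simp
    then show ?thesis using pick_card_in_set[of "k + i" "{k..<n}"] that by simp
  qed
  show ?thesis
    unfolding submatrix_def carrier_matD[OF A] S by (rule eq_matI) (simp_all add: pick)
qed

lemma split_block_symmetric:
  assumes A: "A \<in> carrier_mat n n" and sym: "transpose_mat A = A" and k: "k \<le> n"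
  obtains B C D where
    "split_block A k k = (B, C, transpose_mat C, D)"
    "B \<in> carrier_mat k k" "C \<in> carrier_mat k (n - k)" "D \<in> carrier_mat (n - k) (n - k)"
    "A = four_block_mat B C (transpose_mat C) D" "transpose_mat B = B" "transpose_mat D = D"
    "D = submatrix A {k..<n} {k..<n}"
proof -
  obtain B C C' D where split: "split_block A k k = (B, C, C', D)" by (metis prod_cases4)
  have dims: "dim_row A = k + (n - k)" "dim_col A = k + (n - k)" using A k by auto
  note block = split_block[OF split dims]
  have "transpose_mat A $$ (i, j) = A $$ (i, j)" for i j by (simp only: sym)
  then have sym': "A $$ (j, i) = A $$ (i, j)" if "i < n" "j < n" for i j
    using A that by (metis carrier_matD index_transpose_mat(1))
  have C': "C' = transpose_mat C" and sym_D: "transpose_mat B = B" "transpose_mat D = D"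
    "D = submatrix A {k..<n} {k..<n}"
    unfolding submatrix_atLeastLessThan[OF A k]
    using split A k by (auto simp: split_block_def Let_def ac_simps intro!: eq_matI sym')
  from that[OF split[unfolded C'] block(1,2,4) block(5)[unfolded C'] sym_D] show thesis .
qed

lemma mat_inv_mult_vec:
  assumes "invertible_mat A" "A \<in> carrier_mat n n" "v \<in> carrier_vec n"
  shows "A *\<^sub>v (mat_inv A *\<^sub>v v) = v" "mat_inv A *\<^sub>v (A *\<^sub>v v) = v"
  using assoc_mult_mat_vec[OF assms(2) mat_inv(1)[OF assms(1,2)] assms(3)]
    assoc_mult_mat_vec[OF mat_inv(1)[OF assms(1,2)] assms(2,3)] mat_inv(2,3)[OF assms(1,2)] assms(3)
  by simp_all

text \<open>By symmetry the transposed inverse is a left inverse of \<open>A\<close>, and a left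
  inverse equals the two-sided one.\<close>

lemma transpose_mat_inv:
  assumes inv: "invertible_mat A" and A: "A \<in> carrier_mat n n" and sym: "transpose_mat A = A"
  shows "transpose_mat (mat_inv A) = mat_inv A"
proof -
  note I = mat_inv[OF inv A]
  let ?T = "transpose_mat (mat_inv A)"
  have "?T * A = transpose_mat (A * mat_inv A)"
    using transpose_mult[OF A I(1)] sym by simp
  then have T: "?T * A = 1\<^sub>m n" using I(2) by simp
  have "?T = ?T * (A * mat_inv A)" using I by simp
  also have "\<dots> = ?T * A * mat_inv A"
    using I A by (intro assoc_mult_mat[symmetric, of _ n n _ n _ n]) auto
  also have "\<dots> = mat_inv A" using I T by simp
  finally show ?thesis .
qed

section \<open>Kron reduction of symmetric matrices\<close>

lemma kron_reduction_symmetric: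
  assumes A: "A \<in> carrier_mat n n" "transpose_mat A = A" and k: "k \<le> n"
    and inv: "invertible_mat (submatrix A {k..<n} {k..<n})"
  shows "kron_reduction A k \<in> carrier_mat k k"
    "transpose_mat (kron_reduction A k) = kron_reduction A k"
proof -
  from A k obtain B C D where split: "split_block A k k = (B, C, transpose_mat C, D)"
    and B: "B \<in> carrier_mat k k" and C: "C \<in> carrier_mat k (n - k)"
    and D: "D \<in> carrier_mat (n - k) (n - k)"
    and sym: "transpose_mat B = B" "transpose_mat D = D"
    and D_eq: "D = submatrix A {k..<n} {k..<n}"
    by (rule split_block_symmetric)
  have inv: "invertible_mat D" using inv D_eq by simp
  note I = mat_inv[OF inv D] and T = transpose_mat_inv[OF inv D sym(2)]
  let ?M = "C * mat_inv D * transpose_mat C"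
  have K: "kron_reduction A k = B - ?M" by (simp add: kron_reduction_def split)
  have M: "?M \<in> carrier_mat k k" using C I by simp
  have "transpose_mat ?M = C * (transpose_mat (mat_inv D) * transpose_mat C)"
    using C I transpose_mult[of "C * mat_inv D" k "n - k" "transpose_mat C" k] transpose_mult[OF C I(1)]
    by simp
  also have "\<dots> = ?M"
    unfolding T using C I by (intro assoc_mult_mat[symmetric, of _ k "n - k" _ "n - k" _ k]) auto
  finally have "transpose_mat ?M = ?M" .
  then show "transpose_mat (kron_reduction A k) = kron_reduction A k"
    unfolding K using transpose_minus[OF B M] sym by simp
  show "kron_reduction A k \<in> carrier_mat k k" unfolding K using M by (rule minus_carrier_mat)
qed

text \<open>Block elimination: the lower rows carry no injection, so they express \<open>v\<close>
  through \<open>u\<close>, and substitution into the upper rows leaves the Schur complement acting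
  on \<open>u\<close>.\<close>

lemma kron_reduction_mult_vec:
  assumes A: "A \<in> carrier_mat n n" "transpose_mat A = A" and k: "k \<le> n"
    and inv: "invertible_mat (submatrix A {k..<n} {k..<n})"
    and u: "u \<in> carrier_vec k" and v: "v \<in> carrier_vec (n - k)" and b: "b \<in> carrier_vec k"
    and eq: "A *\<^sub>v (u @\<^sub>v v) = b @\<^sub>v 0\<^sub>v (n - k)"
  shows "kron_reduction A k *\<^sub>v u = b"
proof -
  from A k obtain B C D where split: "split_block A k k = (B, C, transpose_mat C, D)"
    and B: "B \<in> carrier_mat k k" and C: "C \<in> carrier_mat k (n - k)"
    and D: "D \<in> carrier_mat (n - k) (n - k)"
    and A_eq: "A = four_block_mat B C (transpose_mat C) D"
    and D_eq: "D = submatrix A {k..<n} {k..<n}"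
    by (rule split_block_symmetric)
  have inv: "invertible_mat D" using inv D_eq by simp
  note I = mat_inv[OF inv D]
  define w where "w = transpose_mat C *\<^sub>v u"
  have w: "w \<in> carrier_vec (n - k)" using C u by (simp add: w_def)
  have Bu: "B *\<^sub>v u \<in> carrier_vec k" and Cv: "C *\<^sub>v v \<in> carrier_vec k"
    and Dv: "D *\<^sub>v v \<in> carrier_vec (n - k)" using B C D u v by simp_all
  have "(B *\<^sub>v u + C *\<^sub>v v) @\<^sub>v (w + D *\<^sub>v v) = b @\<^sub>v 0\<^sub>v (n - k)"
    using eq C unfolding A_eq w_def by (subst (asm) four_block_mat_mult_vec[OF B C _ D u v]) auto
  then have b_eq: "b = B *\<^sub>v u + C *\<^sub>v v" and 0: "w + D *\<^sub>v v = 0\<^sub>v (n - k)"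
    using Bu Cv b by (auto simp: append_vec_eq[of _ k])
  have w_eq: "w = - (D *\<^sub>v v)"
  proof (rule eq_vecI)
    fix i assume "i < dim_vec (- (D *\<^sub>v v))"
    then have i: "i < n - k" using D by simp
    then have "(w + D *\<^sub>v v) $ i = 0" unfolding 0 by simp
    then show "w $ i = (- (D *\<^sub>v v)) $ i"
      using i w Dv D by (simp add: eq_neg_iff_add_eq_0)
  qed (use w D in auto)
  \<comment> \<open>Since \<open>w\<close> is the transpose of \<open>C\<close> applied to
    \<open>u\<close>, this is the elimination formula for \<open>v\<close>.\<close>
  have "mat_inv D *\<^sub>v w = - v"
  proof -
    have "- (D *\<^sub>v v) = D *\<^sub>v (- v)" by (rule eq_vecI) (use D v in auto)
    then show ?thesis using mat_inv_mult_vec(2)[OF inv D, of "- v"] v w_eq by simp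
  qed
  moreover have "(C * mat_inv D * transpose_mat C) *\<^sub>v u = C *\<^sub>v (mat_inv D *\<^sub>v w)"
    using C I u by (simp add: w_def assoc_mult_mat_vec[of _ k "n - k" _ k]
      assoc_mult_mat_vec[of _ k "n - k" _ "n - k"])
  moreover have "C *\<^sub>v (- v) = - (C *\<^sub>v v)" by (rule eq_vecI) (use C v in auto)
  ultimately have "(C * mat_inv D * transpose_mat C) *\<^sub>v u = - (C *\<^sub>v v)" by simp
  then have "kron_reduction A k *\<^sub>v u = B *\<^sub>v u - - (C *\<^sub>v v)"
    using B C I u by (simp add: kron_reduction_def split minus_mult_distrib_mat_vec[of _ k k])
  also have "\<dots> = b" unfolding b_eq by (rule eq_vecI) (use Bu Cv in auto)
  finally show ?thesis .
qed

section \<open>Admittance matrices\<close>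

lemma admittance_matrix_carrier [simp]: "admittance_matrix G a y s \<in> carrier_mat a a"
  by (simp add: admittance_matrix_def)

context electrical_network
begin

lemma transpose_admittance_matrix:
  "transpose_mat (admittance_matrix G a y s) = admittance_matrix G a y s"
proof -
  have "(m, n) \<in> parcs G \<longleftrightarrow> (n, m) \<in> parcs G" for m n
    using pair_sym_arcs by (auto simp: symmetric_def sym_def)
  then show ?thesis
    by (intro eq_matI) (auto simp: admittance_matrix_def intro: admittance_sym)
qed

text \<open>Each branch at \<open>m\<close> enters the diagonal entry with a plus and one
  off-diagonal entry with a minus, so only the shunt survives.\<close>

lemma admittance_matrix_row_sum:
  assumes m: "m < a"
  shows "(\<Sum>n<a. admittance_matrix G a y s $$ (m, n)) = s m"
proof -
  let ?K = "{k. (m, k) \<in> parcs G}"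
  have K: "?K \<subseteq> {..<a}" and m_notin: "m \<notin> ?K"
    using in_arcsD2 nodes pair_no_loops by fastforce+
  have "(\<Sum>n<a. admittance_matrix G a y s $$ (m, n)) =
    (\<Sum>n<a. (if n = m then s m + sum (y m) ?K else 0) - (if n \<in> ?K then y m n else 0))"
    using m m_notin by (intro sum.cong) (auto simp: admittance_matrix_def)
  also have "\<dots> = s m + sum (y m) ?K - sum (y m) ({..<a} \<inter> ?K)"
    using m by (simp add: sum_subtractf sum.inter_restrict)
  also have "{..<a} \<inter> ?K = ?K" using K by auto
  finally show ?thesis by simp
qed

text \<open>Current conservation: the total injected current leaves through the shunts. Symmetry
  turns the column sums that arise into row sums.\<close>

lemma sum_admittance_matrix_mult_vec:
  assumes x: "x \<in> carrier_vec a"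
  shows "(\<Sum>m<a. (admittance_matrix G a y s *\<^sub>v x) $ m) = (\<Sum>m<a. s m * x $ m)"
proof -
  let ?A = "admittance_matrix G a y s"
  have sym: "?A $$ (m, n) = ?A $$ (n, m)" if "m < a" "n < a" for m n
    using transpose_admittance_matrix that
    by (metis admittance_matrix_carrier carrier_matD index_transpose_mat(1))
  have "(\<Sum>m<a. (?A *\<^sub>v x) $ m) = (\<Sum>m<a. \<Sum>n<a. ?A $$ (m, n) * x $ n)"
    using x by (intro sum.cong)
      (auto simp: scalar_prod_def lessThan_atLeast0 admittance_matrix_def)
  also have "\<dots> = (\<Sum>n<a. \<Sum>m<a. ?A $$ (n, m) * x $ n)"
    by (subst sum.swap) (auto intro!: sum.cong simp: sym)
  also have "\<dots> = (\<Sum>n<a. s n * x $ n)"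
    by (simp add: admittance_matrix_row_sum flip: sum_distrib_right)
  finally show ?thesis .
qed

section \<open>Potentials in a network without shunts\<close>

lemma ex_potential_no_shunts:
  assumes inv: "invertible_mat (submatrix (admittance_matrix G a y s) {1..<a} {1..<a})"
    and s: "\<And>m. m < a \<Longrightarrow> s m = 0"
    and b: "b \<in> carrier_vec a" and sum_b: "(\<Sum>m<a. b $ m) = 0"
  shows "\<exists>x \<in> carrier_vec a. admittance_matrix G a y s *\<^sub>v x = b"
proof -
  define A where "A = admittance_matrix G a y s"
  have A: "A \<in> carrier_mat a a" and T: "transpose_mat A = A"
    by (simp_all add: A_def transpose_admittance_matrix)
  have a: "1 \<le> a" using boundary by simp
  from A T a obtain B C D where B: "B \<in> carrier_mat 1 1" and C: "C \<in> carrier_mat 1 (a - 1)"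
    and D: "D \<in> carrier_mat (a - 1) (a - 1)"
    and A_eq: "A = four_block_mat B C (transpose_mat C) D"
    and D_eq: "D = submatrix A {1..<a} {1..<a}"
    by (rule split_block_symmetric)
  have inv: "invertible_mat D" using inv D_eq by (simp add: A_def)
  define b' where "b' = vec_last b (a - 1)"
  have b': "b' \<in> carrier_vec (a - 1)" by (simp add: b'_def)
  define v where "v = mat_inv D *\<^sub>v b'"
  have v: "v \<in> carrier_vec (a - 1)" using mat_inv(1)[OF inv D] b' by (simp add: v_def)
  \<comment> \<open>Node 0 is the reference at potential 0; \<open>v\<close> solves the equations of
    all other nodes, whose injections form \<open>b'\<close>.\<close>
  define x where "x = 0\<^sub>v 1 @\<^sub>v v"
  have x: "x \<in> carrier_vec a" using a append_carrier_vec[of "0\<^sub>v 1" 1 v "a - 1"] v by (simp add: x_def)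
  have Cv: "C *\<^sub>v v \<in> carrier_vec 1" using C v by simp
  have Ax: "A *\<^sub>v x = C *\<^sub>v v @\<^sub>v b'"
  proof -
    have "D *\<^sub>v v = b'" unfolding v_def using inv D b' by (rule mat_inv_mult_vec)
    moreover have "B *\<^sub>v 0\<^sub>v 1 = 0\<^sub>v 1" "transpose_mat C *\<^sub>v 0\<^sub>v 1 = 0\<^sub>v (a - 1)"
      using B C by (intro mult_mat_zero_vec, auto)+
    moreover have "0\<^sub>v 1 + C *\<^sub>v v = C *\<^sub>v v" "0\<^sub>v (a - 1) + b' = b'"
      using Cv b' by simp_all
    ultimately show ?thesis
      using C unfolding A_eq x_def by (subst four_block_mat_mult_vec[OF B C _ D _ v]) auto
  qed
  have rest: "(A *\<^sub>v x) $ m = b $ m" if "m < a" "m \<noteq> 0" for m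
    unfolding Ax using that b by (subst index_append_vec) (use C in \<open>auto simp: b'_def vec_last_def\<close>)
  \<comment> \<open>Both totals vanish: the left one by current conservation without shunts, the
    right one by \<open>sum_b\<close>. Agreement at all nodes but 0 then forces agreement at node
    0.\<close>
  have "(\<Sum>m<a. (A *\<^sub>v x) $ m) = (\<Sum>m<a. b $ m)"
    unfolding A_def sum_admittance_matrix_mult_vec[OF x] sum_b using s by simp
  moreover have "{..<a} = insert 0 {1..<a}" using a by auto
  moreover have "(\<Sum>m\<in>{1..<a}. (A *\<^sub>v x) $ m) = (\<Sum>m\<in>{1..<a}. b $ m)"
    by (intro sum.cong) (auto simp: rest)
  ultimately have "(A *\<^sub>v x) $ 0 = b $ 0" by simp
  with rest have "(A *\<^sub>v x) $ m = b $ m" if "m < a" for m using that by (cases "m = 0") simp_all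
  then have "A *\<^sub>v x = b" by (rule eq_vecI) (use A b in simp_all)
  with x show ?thesis unfolding A_def by blast
qed

lemma sum_node_diff:
  assumes "n < a" "m < a"
  shows "(\<Sum>k<a. node_diff a n m $ k) = 0"
  using assms by (simp add: node_diff_def unit_vec_def sum_subtractf)

section \<open>The network augmented by a ground node\<close>

lemma augmented_admittance_matrix_carrier:
  "augmented_admittance_matrix G a y s \<in> carrier_mat (a + 1) (a + 1)"
  unfolding augmented_admittance_matrix_def by (intro four_block_carrier_mat) auto

lemma transpose_augmented_admittance_matrix:
  "transpose_mat (augmented_admittance_matrix G a y s) = augmented_admittance_matrix G a y s"
proof -
  have "transpose_mat (- mat_of_cols a [vec a s]) = - mat_of_rows a [vec a s]"
    "transpose_mat (- mat_of_rows a [vec a s]) = - mat_of_cols a [vec a s]"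
    by (auto intro!: eq_matI simp: mat_of_rows_index mat_of_cols_index)
  moreover have "transpose_mat (mat 1 1 f) = mat 1 1 f" for f :: "nat \<times> nat \<Rightarrow> complex"
    by (auto intro!: eq_matI)
  ultimately show ?thesis
    unfolding augmented_admittance_matrix_def
    by (subst transpose_four_block_mat[of _ a a _ 1 _ 1]) (auto simp: transpose_admittance_matrix)
qed

text \<open>With the ground at potential 0 the node equations do not change. The ground row yields
  minus the total shunt current, which by current conservation is the sum of the injections, hence
  0.\<close>

lemma augmented_admittance_matrix_mult_vec:
  assumes x: "x \<in> carrier_vec a"
    and balanced: "(\<Sum>m<a. (admittance_matrix G a y s *\<^sub>v x) $ m) = 0"
  shows "augmented_admittance_matrix G a y s *\<^sub>v (x @\<^sub>v 0\<^sub>v 1) =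
    admittance_matrix G a y s *\<^sub>v x @\<^sub>v 0\<^sub>v 1"
proof -
  let ?A = "admittance_matrix G a y s"
  have Ax: "?A *\<^sub>v x \<in> carrier_vec a"
    using admittance_matrix_carrier x by (rule mult_mat_vec_carrier)
  have "vec a s \<bullet> x = 0"
    using balanced x unfolding sum_admittance_matrix_mult_vec[OF x]
    by (simp add: scalar_prod_def lessThan_atLeast0)
  then have ground: "- mat_of_rows a [vec a s] *\<^sub>v x + mat 1 1 (\<lambda>_. \<Sum>m<a. s m) *\<^sub>v 0\<^sub>v 1 = 0\<^sub>v 1"
    using x by (intro eq_vecI) (auto simp: mat_of_rows_row)
  have "?A *\<^sub>v x + - mat_of_cols a [vec a s] *\<^sub>v 0\<^sub>v 1 = ?A *\<^sub>v x"
    using Ax by (subst mult_mat_zero_vec[of _ a]) auto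
  with ground show ?thesis unfolding augmented_admittance_matrix_def
    by (subst four_block_mat_mult_vec[of _ a a _ 1 _ 1]) (use x in auto)
qed

end

section \<open>The two invariance statements\<close>

theorem theorem3:
  fixes G :: "nat pair_pre_digraph"
    and a N :: nat
    and y :: "nat \<Rightarrow> nat \<Rightarrow> complex"
    and s :: "nat \<Rightarrow> complex"
    and Y\<^sub>A :: "complex mat"
  assumes "electrical_network G a N y s"
    and "Y\<^sub>A = admittance_matrix G a y s"
    and "\<And>S. S \<subset> {..<a} \<Longrightarrow> S \<noteq> {} \<Longrightarrow> invertible_mat (submatrix Y\<^sub>A S S)"
    and "(\<exists>m<a. s m \<noteq> 0) \<Longrightarrow> invertible_mat Y\<^sub>A"
  shows "(\<forall>n<N. \<forall>m<N.
            effective_impedance (kron_reduction Y\<^sub>A N) n m = effective_impedance Y\<^sub>A n m) \<and>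
         (invertible_mat Y\<^sub>A \<longrightarrow> (\<forall>n<a. \<forall>m<a.
            effective_impedance Y\<^sub>A n m = node_diff a n m \<bullet> (mat_inv Y\<^sub>A *\<^sub>v node_diff a n m) \<and>
            node_diff a n m \<bullet> (mat_inv Y\<^sub>A *\<^sub>v node_diff a n m) =
              effective_impedance (augmented_admittance_matrix G a y s) n m))"
proof (intro conjI allI impI)
  interpret electrical_network G a N y s by fact
  have A: "Y\<^sub>A \<in> carrier_mat a a" and T: "transpose_mat Y\<^sub>A = Y\<^sub>A"
    using assms(2) by (simp_all add: transpose_admittance_matrix)
  \<comment> \<open>Needed for \<open>k = 1\<close> (grounding node 0) and \<open>k = N\<close>
    (Kron reduction). Since \<open>1 \<le> k\<close>, node 0 is left out and the index set is
    proper; for \<open>k = a\<close> the block is the empty matrix, which is its own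
    inverse.\<close>
  have sub_inv: "invertible_mat (submatrix Y\<^sub>A {k..<a} {k..<a})" if k: "1 \<le> k" "k \<le> a" for k
  proof (cases "k = a")
    case True
    then have "submatrix Y\<^sub>A {k..<a} {k..<a} = 1\<^sub>m 0"
      unfolding submatrix_atLeastLessThan[OF A k(2)] by auto
    then show ?thesis by (auto simp: invertible_mat_def inverts_mat_def intro!: exI[of _ "1\<^sub>m 0"])
  next
    case False
    then have "{k..<a} \<noteq> {}" using k by simp
    moreover have "0 \<in> {..<a}" "0 \<notin> {k..<a}" using k by auto
    then have "{k..<a} \<noteq> {..<a}" by blast
    then have "{k..<a} \<subset> {..<a}" by (intro psubsetI subsetI) simp_all
    ultimately show ?thesis by (intro assms(3))
  qed
  have potential: "\<exists>x \<in> carrier_vec a. Y\<^sub>A *\<^sub>v x = node_diff a n m" if nm: "n < a" "m < a" for n m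
  \<comment> \<open>With a shunt the matrix is nonsingular by assumption. Without shunts its rows
    sum to zero, so it is singular and a node has to be grounded.\<close>
  proof (cases "\<exists>k<a. s k \<noteq> 0")
    case True
    with assms(4) have inv: "invertible_mat Y\<^sub>A" by simp
    show ?thesis
      using mat_inv_mult_vec(1)[OF inv A, of "node_diff a n m"] mat_inv(1)[OF inv A]
      by (intro bexI[of _ "mat_inv Y\<^sub>A *\<^sub>v node_diff a n m"]) auto
  next
    case False
    then show ?thesis
      using ex_potential_no_shunts[of "node_diff a n m"] sub_inv[of 1] boundary sum_node_diff nm
      by (auto simp: assms(2))
  qed
  {
    fix n m assume nm: "n < N" "m < N"
    obtain x where x: "x \<in> carrier_vec a" and Ax: "Y\<^sub>A *\<^sub>v x = node_diff a n m"
      using potential[of n m] nm boundary by auto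
    define u v where "u = vec_first x N" and "v = vec_last x (a - N)"
    have u: "u \<in> carrier_vec N" and v: "v \<in> carrier_vec (a - N)" by (simp_all add: u_def v_def)
    have x_eq: "x = u @\<^sub>v v" using x boundary by (simp add: u_def v_def)
    \<comment> \<open>Both nodes lie on the boundary, so the interior nodes receive no injection, as
      the elimination requires; the same zeros later remove \<open>v\<close> from the scalar
      product.\<close>
    have d: "node_diff a n m = node_diff N n m @\<^sub>v 0\<^sub>v (a - N)"
      using node_diff_append[OF nm, of "a - N"] boundary by simp
    note inv = sub_inv[OF boundary]
    have "kron_reduction Y\<^sub>A N *\<^sub>v u = node_diff N n m"
      using Ax u v unfolding x_eq d
      by (intro kron_reduction_mult_vec[OF A T boundary(2) inv u v]) auto
    then have "effective_impedance (kron_reduction Y\<^sub>A N) n m = node_diff N n m \<bullet> u"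
      by (intro effective_impedance_eq_scalar_prod u kron_reduction_symmetric[OF A T boundary(2) inv])
    also have "\<dots> = node_diff a n m \<bullet> x"
      unfolding x_eq d using u v by (subst scalar_prod_append) auto
    also have "\<dots> = effective_impedance Y\<^sub>A n m"
      using effective_impedance_eq_scalar_prod[OF A T x Ax] by simp
    finally show "effective_impedance (kron_reduction Y\<^sub>A N) n m = effective_impedance Y\<^sub>A n m" .
  }
  {
    fix n m assume inv: "invertible_mat Y\<^sub>A" and nm: "n < a" "m < a"
    \<comment> \<open>One potential serves both equalities: its product with the injection is the
      middle expression.\<close>
    define x where "x = mat_inv Y\<^sub>A *\<^sub>v node_diff a n m"
    have x: "x \<in> carrier_vec a" using mat_inv(1)[OF inv A] by (simp add: x_def)
    have Ax: "Y\<^sub>A *\<^sub>v x = node_diff a n m"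
      unfolding x_def using inv A by (rule mat_inv_mult_vec) simp
    show "effective_impedance Y\<^sub>A n m = node_diff a n m \<bullet> (mat_inv Y\<^sub>A *\<^sub>v node_diff a n m)"
      using effective_impedance_eq_scalar_prod[OF A T x Ax] by (simp add: x_def)
    have d: "node_diff (a + 1) n m = node_diff a n m @\<^sub>v 0\<^sub>v 1" using nm by (rule node_diff_append)
    \<comment> \<open>The augmented matrix is singular, as its rows sum to zero, but the injection
      is balanced, so extending \<open>x\<close> by 0 at the ground gives a solution.\<close>
    have "augmented_admittance_matrix G a y s *\<^sub>v (x @\<^sub>v 0\<^sub>v 1) = node_diff (a + 1) n m"
      using augmented_admittance_matrix_mult_vec[OF x] Ax sum_node_diff[OF nm]
      unfolding d by (simp add: assms(2))
    then have "effective_impedance (augmented_admittance_matrix G a y s) n m =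
        node_diff (a + 1) n m \<bullet> (x @\<^sub>v 0\<^sub>v 1)"
      using x by (intro effective_impedance_eq_scalar_prod augmented_admittance_matrix_carrier
        transpose_augmented_admittance_matrix append_carrier_vec) auto
    also have "\<dots> = node_diff a n m \<bullet> x"
      unfolding d using x by (subst scalar_prod_append[of _ a _ 1]) auto
    finally show "node_diff a n m \<bullet> (mat_inv Y\<^sub>A *\<^sub>v node_diff a n m) =
        effective_impedance (augmented_admittance_matrix G a y s) n m"
      by (simp add: x_def)
  }
qed

end
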